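(* Let $(p_n)_{n\ge1}$ be a sequence of primes and $(q_n)_{n\ge1}$ a sequence of prime powers such that $p_n\to\infty$ or $q_n\to\infty$ (or both) as $n\to\infty$, and such that the limit $L=\lim_{n\to\infty}\frac{q_n}{p_n}\in[0,\infty]$ exists. Let $P(q,p)$ be the probability that an element of $\mathbb{F}_q[x]/(x^{q^p}-x)$ chosen uniformly at random is subfield preserving, as a map $\mathbb{F}_{q^p}\to\mathbb{F}_{q^p}$. Then $$\lim_{n\to\infty}P(q_n,p_n)=e^{-L},$$ with the convention $e^{-\infty}=0$.
   Context: For a prime power $q$ and a natural number $m\ge1$, a map $f:\mathbb{F}_{q^m}\to\mathbb{F}_{q^m}$ is called subfield preserving if $f(\mathbb{F}_q)\subseteq\mathbb{F}_q$ and, for all positive divisors $d,s$ of $m$, $f(\mathbb{F}_{q^d}\setminus\mathbb{F}_{q^s})\subseteq\mathbb{F}_{q^d}\setminus\mathbb{F}_{q^s}$. Here $m=p$ is prime. Each element of $\mathbb{F}_q[x]/(x^{q^p}-x)$ induces by evaluation a well-defined map $\mathbb{F}_{q^p}\to\mathbb{F}_{q^p}$, and distinct elements induce distinct maps. *)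

theory Defs
  imports
    "HOL-Algebra.Algebra"
    "HOL-Number_Theory.Prime_Powers"
    "HOL-Probability.Probability"
begin

text \<open>
  A field \<open>K\<close> of order \<open>q ^ m\<close> has exactly one subfield with \<open>q ^ d\<close> elements for every
  \<open>d\<close> dividing \<open>m\<close>, so the definite description below is proper in all cases of interest.
\<close>

definition subfield_of_order :: "('a, 'b) ring_scheme \<Rightarrow> nat \<Rightarrow> 'a set"
  where "subfield_of_order K r = (THE F. subfield F K \<and> card F = r)"

definition subfield_preserving ::
    "('a, 'b) ring_scheme \<Rightarrow> nat \<Rightarrow> nat \<Rightarrow> ('a \<Rightarrow> 'a) \<Rightarrow> bool"
  where "subfield_preserving K q m f \<longleftrightarrow>
    f \<in> carrier K \<rightarrow> carrier K \<and>
    f ` subfield_of_order K q \<subseteq> subfield_of_order K q \<and>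
    (\<forall>d s. 0 < d \<and> d dvd m \<and> 0 < s \<and> s dvd m \<longrightarrow>
       f ` (subfield_of_order K (q ^ d) - subfield_of_order K (q ^ s))
         \<subseteq> subfield_of_order K (q ^ d) - subfield_of_order K (q ^ s))"

text \<open>The ring $F_q[x] / (x^{q^m} - x)$, where $F_q$ is the subfield of \<open>K\<close> of order \<open>q\<close>.\<close>

definition reduced_poly_ring ::
    "('a, 'b) ring_scheme \<Rightarrow> nat \<Rightarrow> nat \<Rightarrow> 'a list set ring"
  where "reduced_poly_ring K q m =
    (let P = univ_poly K (subfield_of_order K q)
     in P Quot (PIdl\<^bsub>P\<^esub> (X\<^bsub>K\<^esub> [^]\<^bsub>P\<^esub> (q ^ m) \<ominus>\<^bsub>P\<^esub> X\<^bsub>K\<^esub>)))"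

text \<open>
  If \<open>K\<close> has order \<open>q ^ m\<close>, all representatives of a residue class \<open>C\<close> of the above ring
  have the same value at any given point of \<open>K\<close>.
\<close>

definition induced_map :: "('a, 'b) ring_scheme \<Rightarrow> 'a list set \<Rightarrow> 'a \<Rightarrow> 'a"
  where "induced_map K C x = the_elem ((\<lambda>g. ring.eval K g x) ` C)"

definition prob_subfield_preserving :: "('a, 'b) ring_scheme \<Rightarrow> nat \<Rightarrow> nat \<Rightarrow> real"
  where "prob_subfield_preserving K q m =
    measure_pmf.prob (pmf_of_set (carrier (reduced_poly_ring K q m)))
      {C. subfield_preserving K q m (induced_map K C)}"

definition exp_neg :: "ennreal \<Rightarrow> real"
  where "exp_neg L = (if L = \<infinity> then 0 else exp (- enn2real L))"

end

theory Submission
  imports Defs "HOL-Real_Asymp.Real_Asymp"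
begin

text \<open>
  A residue class of \<open>F_q[x] / (x^(q^p) - x)\<close> is the same thing as a map on \<open>K\<close> that commutes
  with the Frobenius map \<open>s x = x ^ q\<close>. The fixed points of \<open>s\<close> are the \<open>q\<close> elements
  of \<open>F_q\<close>, and since \<open>p\<close> is prime all other orbits have length \<open>p\<close>. A commuting map sends
  \<open>F_q\<close> to itself and is arbitrary on one representative of each of the
  \<open>N = (q^p - q) / p\<close> long orbits; it is subfield preserving iff these representatives are
  sent outside \<open>F_q\<close>. Hence \<open>P(q, p) = (1 - q / q^p) ^ N\<close>. With \<open>u = q / q^p\<close>, which tends
  to \<open>0\<close>, this is \<open>exp ((q / p) * (1 - u) * ln (1 - u) / u)\<close>, and \<open>(1 - u) * ln (1 - u) / u\<close>
  tends to \<open>-1\<close>.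
\<close>

subsection \<open>Maps commuting with a map of prime order\<close>

text \<open>The intended instance is the Frobenius map on a field of order \<open>q ^ p\<close>.
  Periodicity makes \<open>s\<close> a permutation of \<open>A\<close>, and primality of
  \<open>p\<close> leaves only orbits of length 1 and \<open>p\<close>.\<close>

locale prime_cyclic_map =
  fixes A :: "'a set" and s :: "'a \<Rightarrow> 'a" and p :: nat
  assumes finite_A: "finite A"
    and prime_p: "Factorial_Ring.prime p"
    and maps: "x \<in> A \<Longrightarrow> s x \<in> A"
    and periodic: "x \<in> A \<Longrightarrow> (s ^^ p) x = x"
begin

definition fixed :: "'a set" where "fixed = {x \<in> A. s x = x}"

definition moved :: "'a set" where "moved = {x \<in> A. s x \<noteq> x}"

text \<open>With \<open>B = A\<close> these are all maps on \<open>A\<close> that commute with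
  \<open>s\<close>; with \<open>B = moved\<close> they are those that send no moved point to a fixed
  point. Extensionality makes each map on \<open>A\<close> count once.\<close>

definition commuting_maps :: "'a set \<Rightarrow> ('a \<Rightarrow> 'a) set"
  where "commuting_maps B = {f \<in> A \<rightarrow>\<^sub>E A. f ` moved \<subseteq> B \<and> (\<forall>x\<in>A. f (s x) = s (f x))}"

lemma p_gt_0: "p > 0" and p_gt_1: "p > 1"
  using prime_gt_0_nat[OF prime_p] prime_gt_1_nat[OF prime_p] by simp_all

lemma funpow_in_A: "x \<in> A \<Longrightarrow> (s ^^ i) x \<in> A"
  by (induction i) (auto simp: maps)

lemma funpow_mult_fixed_point: "(s ^^ i) x = x \<Longrightarrow> (s ^^ (i * k)) x = x"
  by (induction k) (auto simp: funpow_add)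

lemma funpow_mod_p: "x \<in> A \<Longrightarrow> (s ^^ (i mod p)) x = (s ^^ i) x"
proof -
  assume x: "x \<in> A"
  have "(s ^^ i) x = (s ^^ (i mod p + p * (i div p))) x" by simp
  also have "\<dots> = (s ^^ (i mod p)) x"
    unfolding funpow_add using funpow_mult_fixed_point[OF periodic[OF x]] by simp
  finally show ?thesis by simp
qed

text \<open>The iterate of exponent \<open>p * i - i\<close> undoes the one of exponent
  \<open>i\<close>: together they give exponent \<open>p * i\<close>, which is the identity on
  \<open>A\<close>.\<close>

lemma funpow_inj_on_A:
  assumes "x \<in> A" "y \<in> A" "(s ^^ i) x = (s ^^ i) y"
  shows "x = y"
proof -
  have "z = (s ^^ (p * i - i)) ((s ^^ i) z)" if "z \<in> A" for z
  proof -
    have "p * i - i + i = p * i" using p_gt_0 by simp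
    then show ?thesis
      using funpow_mult_fixed_point[OF periodic[OF that], of i]
      by (metis comp_apply funpow_add)
  qed
  then show ?thesis using assms by metis
qed

text \<open>If \<open>s\<close> fixed the \<open>i\<close>-th iterate of \<open>x\<close>, then
  \<open>s x\<close> and \<open>x\<close> would have the same \<open>i\<close>-th iterate, and
  injectivity would make \<open>x\<close> fixed.\<close>

lemma funpow_in_moved: "x \<in> moved \<Longrightarrow> (s ^^ i) x \<in> moved"
  using funpow_inj_on_A[of "s x" x i] funpow_in_A maps
  unfolding moved_def by (auto simp: funpow_swap1)

text \<open>By Bezout some multiple of \<open>i\<close> exceeds a multiple of \<open>p\<close> by
  one; both multiples are periods of \<open>x\<close>, hence so is 1.\<close>

lemma coprime_period_imp_fixed:
  assumes "x \<in> A" "(s ^^ i) x = x" "coprime i p"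
  shows "s x = x"
proof -
  have "p \<noteq> 1" using p_gt_1 by simp
  then obtain u v where uv: "i * u = p * v + 1"
    using coprime_bezout_strong[OF assms(3)] by blast
  have "s x = s ((s ^^ (p * v)) x)"
    using funpow_mult_fixed_point[OF periodic[OF assms(1)]] by simp
  also have "\<dots> = (s ^^ (i * u)) x" by (simp add: uv)
  also have "\<dots> = x" using funpow_mult_fixed_point[OF assms(2)] by simp
  finally show ?thesis .
qed

text \<open>A coincidence between exponents \<open>i < j < p\<close> would make \<open>j - i\<close>
  a period. It is coprime to the prime \<open>p\<close>, so the point would be fixed.\<close>

lemma funpow_inj_on_lessThan:
  assumes x: "x \<in> moved" shows "inj_on (\<lambda>i. (s ^^ i) x) {..<p}"
proof (rule linorder_inj_onI)
  fix i j assume ij: "i < j" "i \<in> {..<p}" "j \<in> {..<p}"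
  show "(s ^^ i) x \<noteq> (s ^^ j) x"
  proof
    assume eq: "(s ^^ i) x = (s ^^ j) x"
    have "j = i + (j - i)" using ij by simp
    then have "(s ^^ i) x = (s ^^ i) ((s ^^ (j - i)) x)"
      using eq by (metis comp_apply funpow_add)
    then have "(s ^^ (j - i)) x = x"
      using funpow_inj_on_A x funpow_in_A unfolding moved_def by force
    moreover have "coprime (j - i) p"
      using ij prime_p
      by (metis coprime_commute diff_le_self lessThan_iff nat_dvd_not_less order.strict_trans1
          prime_imp_coprime zero_less_diff)
    ultimately show False
      using coprime_period_imp_fixed[of x "j - i"] x unfolding moved_def by simp
  qed
qed auto

text \<open>The orbits partition the moved points, and each is run through exactly once by the
  exponents below \<open>p\<close>. Choosing one point per orbit therefore gives coordinates on
  \<open>moved\<close>.\<close>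

lemma exists_representatives:
  obtains R where "R \<subseteq> moved" "bij_betw (\<lambda>(r, i). (s ^^ i) r) (R \<times> {..<p}) moved"
proof
  define orb where "orb x = (\<lambda>i. (s ^^ i) x) ` {..<p}" for x
  \<comment> \<open>The choice depends only on the set \<open>orb x\<close>, so points with equal
    orbits get the same representative. Both \<open>rep_R\<close> and injectivity rest on
    this.\<close>
  define rep where "rep x = (SOME y. y \<in> orb x)" for x
  have self: "x \<in> orb x" for x
    unfolding orb_def using p_gt_0 by (auto intro: image_eqI[where x = 0])
  have rep: "rep x \<in> orb x" for x
    unfolding rep_def using self by (rule someI)
  have orb_UNIV: "orb x = range (\<lambda>i. (s ^^ i) x)" if "x \<in> A" for x
    unfolding orb_def
    by (auto simp: image_iff Bex_def) (metis funpow_mod_p mod_less_divisor p_gt_0 that)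
  have orb_sub: "orb y \<subseteq> orb x" if "x \<in> A" "y \<in> orb x" for x y
  proof -
    from that obtain i where y: "y = (s ^^ i) x" unfolding orb_def by auto
    then have "y \<in> A" using funpow_in_A that by simp
    show ?thesis
      unfolding orb_UNIV[OF \<open>y \<in> A\<close>] orb_UNIV[OF that(1)] unfolding y
      by (auto simp flip: funpow_add[unfolded fun_eq_iff comp_apply, rule_format])
  qed
  have orb_sym: "x \<in> orb y" if "x \<in> A" "y \<in> orb x" for x y
  proof -
    from that obtain i where y: "y = (s ^^ i) x" and i: "i < p" unfolding orb_def by auto
    have "x = (s ^^ (p - i + i)) x" using i periodic that by simp
    also have "\<dots> = (s ^^ (p - i)) y" unfolding y funpow_add by simp
    finally show ?thesis using orb_UNIV[of y] funpow_in_A that y by auto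
  qed
  have orb_eq: "orb y = orb x" if "x \<in> A" "y \<in> orb x" for x y
  proof -
    have "y \<in> A" using that funpow_in_A unfolding orb_def by auto
    then show ?thesis using orb_sub that orb_sym by blast
  qed
  have orb_moved: "orb x \<subseteq> moved" if "x \<in> moved" for x
    using funpow_in_moved that unfolding orb_def by auto
  have movedA: "x \<in> A" if "x \<in> moved" for x using that unfolding moved_def by simp
  define R where "R = rep ` moved"
  show R: "R \<subseteq> moved" unfolding R_def using rep orb_moved by blast
  have rep_R: "rep r = r" if "r \<in> R" for r
  proof -
    from that obtain x where x: "x \<in> moved" "r = rep x" unfolding R_def by auto
    then have "orb r = orb x" using orb_eq movedA rep by simp
    then show ?thesis using x unfolding rep_def by simp
  qed
  show "bij_betw (\<lambda>(r, i). (s ^^ i) r) (R \<times> {..<p}) moved"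
    unfolding bij_betw_def
  proof
    show "inj_on (\<lambda>(r, i). (s ^^ i) r) (R \<times> {..<p})"
    proof (rule inj_onI, clarsimp)
      fix r i t j assume *: "r \<in> R" "t \<in> R" "i < p" "j < p" "(s ^^ i) r = (s ^^ j) t"
      have "(s ^^ i) r \<in> orb r" "(s ^^ j) t \<in> orb t"
        using *(3,4) unfolding orb_def by blast+
      then have "orb r = orb t" using orb_eq * R movedA by (metis subsetD)
      then have "r = t" using rep_R * unfolding rep_def by metis
      then show "r = t \<and> i = j"
        using * R funpow_inj_on_lessThan[of r] by (auto dest: inj_onD)
    qed
    show "(\<lambda>(r, i). (s ^^ i) r) ` (R \<times> {..<p}) = moved"
    proof
      show "(\<lambda>(r, i). (s ^^ i) r) ` (R \<times> {..<p}) \<subseteq> moved"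
        using R funpow_in_moved by auto
      show "moved \<subseteq> (\<lambda>(r, i). (s ^^ i) r) ` (R \<times> {..<p})"
      proof
        fix x assume x: "x \<in> moved"
        have "x \<in> orb (rep x)" using orb_sym[OF movedA[OF x] rep] .
        then show "x \<in> (\<lambda>(r, i). (s ^^ i) r) ` (R \<times> {..<p})"
          using x unfolding R_def orb_def by force
      qed
    qed
  qed
qed

section \<open>Counting the commuting maps\<close>

lemma commuting_maps_funpow:
  "f \<in> commuting_maps B \<Longrightarrow> x \<in> A \<Longrightarrow> f ((s ^^ i) x) = (s ^^ i) (f x)"
  by (induction i) (auto simp: commuting_maps_def funpow_in_A)

text \<open>
  A map commuting with \<open>s\<close> is determined by its values at the fixed points, which must be
  fixed points, and its values at one point of each nontrivial orbit, which are arbitrary.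
\<close>

lemma card_commuting_maps:
  assumes B: "B \<subseteq> A" "\<And>x. x \<in> B \<Longrightarrow> s x \<in> B"
  shows "card (commuting_maps B) = card fixed ^ card fixed * card B ^ (card moved div p)"
proof -
  obtain R where R: "R \<subseteq> moved" and h: "bij_betw (\<lambda>(r, i). (s ^^ i) r) (R \<times> {..<p}) moved"
    using exists_representatives .
  have moved_A: "moved \<subseteq> A" "fixed \<subseteq> A" by (auto simp: fixed_def moved_def)
  have finite: "finite R" "finite fixed"
    using finite_subset[OF _ finite_A] R moved_A by blast+
  have cardR: "card R = card moved div p"
    using bij_betw_same_card[OF h, symmetric] p_gt_0 by (simp add: card_cartesian_product)
  have R_fixed: "R \<inter> fixed = {}" using R by (auto simp: fixed_def moved_def)
  \<comment> \<open>\<open>T r\<close> is the set of admissible values at \<open>r\<close>. The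
    claim is that restriction to \<open>fixed \<union> R\<close> leaves these values entirely
    free.\<close>
  define T where "T r = (if r \<in> fixed then fixed else B)" for r
  have Bpow: "(s ^^ i) x \<in> B" if "x \<in> B" for x i using that B by (induction i) auto
  have "bij_betw (\<lambda>f. restrict f (fixed \<union> R)) (commuting_maps B) (Pi\<^sub>E (fixed \<union> R) T)"
    unfolding bij_betw_def
  proof
    show "inj_on (\<lambda>f. restrict f (fixed \<union> R)) (commuting_maps B)"
    proof (rule inj_onI)
      fix f g assume f: "f \<in> commuting_maps B" and g: "g \<in> commuting_maps B"
        and eq: "restrict f (fixed \<union> R) = restrict g (fixed \<union> R)"
      have eq': "f x = g x" if "x \<in> fixed \<union> R" for x
        using fun_cong[OF eq, of x] that by simp
      have "f \<in> A \<rightarrow>\<^sub>E A" "g \<in> A \<rightarrow>\<^sub>E A"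
        using f g by (simp_all add: commuting_maps_def)
      then show "f = g"
      proof (rule PiE_ext)
        fix x assume "x \<in> A"
        then have "x \<in> fixed \<or> x \<in> moved" by (auto simp: fixed_def moved_def)
        then consider "x \<in> fixed" | "x \<in> moved" by blast
        then show "f x = g x"
        proof cases
          case 2
          then obtain r i where ri: "r \<in> R" "x = (s ^^ i) r"
            using bij_betw_imp_surj_on[OF h] by force
          then have "r \<in> A" using R moved_A by auto
          then show ?thesis
            using ri eq' commuting_maps_funpow[OF f] commuting_maps_funpow[OF g] by simp
        qed (use eq' in auto)
      qed
    qed
    show "(\<lambda>f. restrict f (fixed \<union> R)) ` commuting_maps B = Pi\<^sub>E (fixed \<union> R) T"
    proof
      show "(\<lambda>f. restrict f (fixed \<union> R)) ` commuting_maps B \<subseteq> Pi\<^sub>E (fixed \<union> R) T"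
      proof clarify
        fix f assume f: "f \<in> commuting_maps B"
        have "f x \<in> fixed" if "x \<in> fixed" for x
          using f that unfolding commuting_maps_def fixed_def by (auto simp: PiE_def Pi_def)
        moreover have "f x \<in> B" if "x \<in> R" for x
          using f that R unfolding commuting_maps_def by auto
        ultimately show "restrict f (fixed \<union> R) \<in> Pi\<^sub>E (fixed \<union> R) T"
          using R_fixed by (auto simp: T_def PiE_def Pi_def)
      qed
      show "Pi\<^sub>E (fixed \<union> R) T \<subseteq> (\<lambda>f. restrict f (fixed \<union> R)) ` commuting_maps B"
      proof
        fix g assume g: "g \<in> Pi\<^sub>E (fixed \<union> R) T"
        have g_fixed: "g x \<in> fixed" if "x \<in> fixed" for x
          using PiE_mem[OF g, of x] that by (auto simp: T_def)
        have g_R: "g x \<in> B" if "x \<in> R" for x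
          using PiE_mem[OF g, of x] that R_fixed by (auto simp: T_def split: if_splits)
        \<comment> \<open>\<open>k\<close> reads off the coordinates of a moved point. The map
          \<open>f\<close> then extends \<open>g\<close> along each orbit in the only way compatible
          with \<open>s\<close>.\<close>
        define k where "k = the_inv_into (R \<times> {..<p}) (\<lambda>(r, i). (s ^^ i) r)"
        define f where "f = restrict (\<lambda>x. if x \<in> fixed then g x
            else (s ^^ snd (k x)) (g (fst (k x)))) A"
        have f_fixed: "f x = g x" if "x \<in> fixed" for x
          using that moved_A by (auto simp: f_def)
        have k: "k ((s ^^ i) r) = (r, i)" if "r \<in> R" "i < p" for r i
          using the_inv_into_f_f[OF bij_betw_imp_inj_on[OF h], of "(r, i)"] that
          unfolding k_def by simp
        have f_lt: "f ((s ^^ i) r) = (s ^^ i) (g r)" if "r \<in> R" "i < p" for r i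
        proof -
          have "(s ^^ i) r \<in> moved" using funpow_in_moved R that by auto
          then show ?thesis using k[OF that] unfolding f_def by (auto simp: fixed_def moved_def)
        qed
        have f_moved: "f ((s ^^ i) r) = (s ^^ i) (g r)" if "r \<in> R" for r i
        proof -
          have "r \<in> A" "g r \<in> A" using that R moved_A g_R B by auto
          then show ?thesis
            using f_lt[OF that, of "i mod p"] p_gt_0 by (simp add: funpow_mod_p)
        qed
        have f_B: "f x \<in> B" if x: "x \<in> moved" for x
        proof -
          obtain r i where "r \<in> R" "x = (s ^^ i) r"
            using bij_betw_imp_surj_on[OF h] x by force
          then show ?thesis using f_moved Bpow g_R by simp
        qed
        have f_comm: "f (s x) = s (f x)" if "x \<in> A" for x
        proof -
          have "x \<in> fixed \<or> x \<in> moved" using that by (auto simp: fixed_def moved_def)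
          then consider "x \<in> fixed" | "x \<in> moved" by blast
          then show ?thesis
          proof cases
            case 1
            then show ?thesis using f_fixed g_fixed[OF 1] unfolding fixed_def by simp
          next
            case 2
            then obtain r i where ri: "r \<in> R" "x = (s ^^ i) r"
              using bij_betw_imp_surj_on[OF h] by force
            then show ?thesis using f_moved[OF ri(1), of i] f_moved[OF ri(1), of "Suc i"] by simp
          qed
        qed
        have f_ext: "f \<in> extensional A" by (simp add: f_def)
        have "f x \<in> A" if "x \<in> A" for x
        proof -
          have "x \<in> fixed \<or> x \<in> moved" using that by (auto simp: fixed_def moved_def)
          then consider "x \<in> fixed" | "x \<in> moved" by blast
          then show ?thesis using f_fixed g_fixed f_B B moved_A by cases auto
        qed
        then have "f \<in> commuting_maps B"
          unfolding commuting_maps_def PiE_iff using f_comm f_B f_ext by auto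
        moreover have "restrict f (fixed \<union> R) = g"
        proof
          fix x show "restrict f (fixed \<union> R) x = g x"
            using f_fixed[of x] f_moved[of x 0] PiE_arb[OF g, of x] by auto
        qed
        ultimately show "g \<in> (\<lambda>f. restrict f (fixed \<union> R)) ` commuting_maps B" by force
      qed
    qed
  qed
  then have "card (commuting_maps B) = (\<Prod>r\<in>fixed \<union> R. card (T r))"
    using finite by (simp add: bij_betw_same_card card_PiE)
  also have "\<dots> = (\<Prod>r\<in>fixed. card (T r)) * (\<Prod>r\<in>R. card (T r))"
    using finite R_fixed by (intro prod.union_disjoint) auto
  also have "(\<Prod>r\<in>R. card (T r)) = (\<Prod>r\<in>R. card B)"
    using R_fixed by (intro prod.cong) (auto simp: T_def)
  finally show ?thesis by (simp add: T_def cardR)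
qed

text \<open>Makes the division in the exponent of \<open>card_commuting_maps\<close> exact.\<close>

lemma p_dvd_card_moved: "p dvd card moved"
proof -
  obtain R where "bij_betw (\<lambda>(r, i). (s ^^ i) r) (R \<times> {..<p}) moved"
    using exists_representatives .
  from bij_betw_same_card[OF this, symmetric] show ?thesis
    by (simp add: card_cartesian_product)
qed

end

subsection \<open>Powers in rings of prime characteristic and finite fields\<close>

text \<open>Induction with Pascal's rule. Multiplying by \<open>x\<close> and by \<open>y\<close>
  gives two sums, and an index shift in the second lets both run over the same monomials
  \<open>f i\<close>.\<close>

lemma (in cring) binomial_expansion:
  assumes x: "x \<in> carrier R" and y: "y \<in> carrier R"
  shows "(x \<oplus> y) [^] (n::nat) = (\<Oplus>i\<in>{..n}. add_pow R (n choose i) (x [^] i \<otimes> y [^] (n - i)))"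
proof (induction n)
  case 0
  show ?case using x y by simp
next
  case (Suc n)
  define S where "S = (\<Oplus>i\<in>{..n}. add_pow R (n choose i) (x [^] i \<otimes> y [^] (n - i)))"
  define f where "f i = x [^] Suc i \<otimes> y [^] (n - i)" for i
  have f: "f i \<in> carrier R" for i unfolding f_def using x y by simp
  have S: "S \<in> carrier R" unfolding S_def using x y by (intro finsum_closed) auto
  have Sx: "S \<otimes> x = (\<Oplus>i\<in>{..n}. add_pow R (n choose i) (f i))"
  proof -
    have "S \<otimes> x = (\<Oplus>i\<in>{..n}. add_pow R (n choose i) (x [^] i \<otimes> y [^] (n - i)) \<otimes> x)"
      unfolding S_def using x y by (intro finsum_ldistr) auto
    also have "\<dots> = (\<Oplus>i\<in>{..n}. add_pow R (n choose i) (f i))"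
      using x y by (intro finsum_cong') (auto simp: f_def add_pow_ldistr add_pow_rdistr m_ac)
    finally show ?thesis .
  qed
  have Sy: "S \<otimes> y = (\<Oplus>i\<in>{..n}. add_pow R (n choose Suc i) (f i)) \<oplus> y [^] Suc n"
  proof -
    have "S \<otimes> y = (\<Oplus>i\<in>{..n}. add_pow R (n choose i) (x [^] i \<otimes> y [^] (n - i)) \<otimes> y)"
      unfolding S_def using x y by (intro finsum_ldistr) auto
    also have "\<dots> = (\<Oplus>i\<in>{..n}. add_pow R (n choose i) (x [^] i \<otimes> y [^] (Suc n - i)))"
      using x y by (intro finsum_cong') (auto simp: add_pow_ldistr m_assoc Suc_diff_le)
    \<comment> \<open>The added term vanishes because \<open>n choose Suc n\<close> is 0; it is
      there so that splitting off the term at 0 leaves a sum over \<open>{..n}\<close>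
      again.\<close>
    also have "\<dots> = (\<Oplus>i\<in>{..Suc n}. add_pow R (n choose i) (x [^] i \<otimes> y [^] (Suc n - i)))"
      using x y by (subst finsum_Suc) (auto simp: binomial_eq_0 intro!: finsum_closed)
    also have "\<dots> = (\<Oplus>i\<in>{..n}. add_pow R (n choose Suc i) (f i)) \<oplus> y [^] Suc n"
      using x y by (subst finsum_Suc2) (auto simp: f_def)
    finally show ?thesis .
  qed
  have "(x \<oplus> y) [^] Suc n = S \<otimes> x \<oplus> S \<otimes> y"
    using x y S Suc.IH unfolding S_def[symmetric] by (simp add: r_distr)
  also have "\<dots> = ((\<Oplus>i\<in>{..n}. add_pow R (n choose i) (f i)) \<oplus> (\<Oplus>i\<in>{..n}. add_pow R (n choose Suc i) (f i))) \<oplus> y [^] Suc n"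
    unfolding Sx Sy using x y f by (intro a_assoc[symmetric]) (auto intro!: finsum_closed)
  also have "\<dots> = (\<Oplus>i\<in>{..n}. add_pow R (n choose i) (f i) \<oplus> add_pow R (n choose Suc i) (f i)) \<oplus> y [^] Suc n"
    using f by (subst finsum_addf) auto
  also have "\<dots> = (\<Oplus>i\<in>{..n}. add_pow R (Suc n choose Suc i) (f i)) \<oplus> y [^] Suc n"
    using f by (simp add: add.nat_pow_mult)
  also have "\<dots> = (\<Oplus>i\<in>{..Suc n}. add_pow R (Suc n choose i) (x [^] i \<otimes> y [^] (Suc n - i)))"
    using x y by (subst finsum_Suc2) (auto simp: f_def)
  finally show ?case .
qed

lemma (in cring) add_pow_eq_zero_if_dvd:
  assumes "add_pow R (r::nat) \<one> = \<zero>" "r dvd m" "z \<in> carrier R"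
  shows "add_pow R m z = \<zero>"
proof -
  obtain k where m: "m = r * k" using assms(2) by auto
  have "add_pow R r z = \<zero>" using assms add_pow_ldistr[of \<one> z r] by simp
  then show ?thesis using add.nat_pow_pow[OF assms(3), of k r] assms(3) by (simp add: m)
qed

text \<open>All binomial coefficients except the first and the last are divisible by
  \<open>r\<close>. Writing \<open>r\<close> as \<open>Suc (Suc m)\<close> allows both end terms to
  be split off.\<close>

lemma (in cring) prime_char_pow_add:
  assumes r: "Factorial_Ring.prime (r::nat)" "add_pow R r \<one> = \<zero>"
    and x: "x \<in> carrier R" and y: "y \<in> carrier R"
  shows "(x \<oplus> y) [^] r = x [^] r \<oplus> y [^] r"
proof -
  obtain m where m: "r = Suc (Suc m)"
    using prime_ge_2_nat[OF r(1)] by (metis add_2_eq_Suc le_Suc_ex)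
  define f where "f i = add_pow R (r choose i) (x [^] i \<otimes> y [^] (r - i))" for i
  have f: "f i \<in> carrier R" for i unfolding f_def using x y by simp
  have f0: "f (Suc i) = \<zero>" if "i \<le> m" for i
  proof -
    have "r dvd r choose Suc i" using that m r(1) by (intro dvd_choose_prime) auto
    then show ?thesis using x y add_pow_eq_zero_if_dvd[OF r(2)] by (simp add: f_def)
  qed
  have "(x \<oplus> y) [^] r = (\<Oplus>i\<in>{..r}. f i)"
    unfolding binomial_expansion[OF x y] f_def ..
  also have "\<dots> = (\<Oplus>i\<in>{..Suc (Suc m)}. f i)" by (simp only: m)
  also have "\<dots> = f (Suc (Suc m)) \<oplus> (\<Oplus>i\<in>{..Suc m}. f i)"
    using f by (intro finsum_Suc) auto
  also have "(\<Oplus>i\<in>{..Suc m}. f i) = (\<Oplus>i\<in>{..m}. f (Suc i)) \<oplus> f 0"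
    using f by (intro finsum_Suc2) auto
  also have "(\<Oplus>i\<in>{..m}. f (Suc i)) = \<zero>"
    using f0 by (intro add.finprod_one_eqI) auto
  finally show ?thesis using x y by (simp add: f_def flip: m)
qed

lemma (in cring) prime_power_char_pow_add:
  assumes r: "Factorial_Ring.prime (r::nat)" "add_pow R r \<one> = \<zero>"
    and x: "x \<in> carrier R" and y: "y \<in> carrier R"
  shows "(x \<oplus> y) [^] (r ^ k) = x [^] (r ^ k) \<oplus> y [^] (r ^ k)"
proof (induction k)
  case (Suc k)
  have "z [^] (r ^ Suc k) = (z [^] (r ^ k)) [^] r" if "z \<in> carrier R" for z
    using that by (simp add: nat_pow_pow mult.commute)
  then show ?case
    using x y prime_char_pow_add[OF r, of "x [^] (r ^ k)" "y [^] (r ^ k)"] Suc by simp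
qed (use x y in simp)

text \<open>The order of the additive group annihilates \<open>\<one>\<close>, so the
  \<open>N\<close>-th power of the \<open>r\<close>-fold sum of \<open>\<one>\<close> is zero; a
  field has no zero divisors.\<close>

lemma (in field) char_of_prime_power_card:
  assumes "card (carrier R) = (r::nat) ^ N"
  shows "add_pow R r \<one> = \<zero>"
proof -
  have pow: "add_pow R (r ^ k) \<one> = add_pow R r \<one> [^] k" for k :: nat
  proof (induction k)
    case (Suc k)
    have "add_pow R (r ^ Suc k) \<one> = add_pow R (r ^ k) (add_pow R r \<one>)"
      by (simp add: add.nat_pow_pow mult.commute)
    also have "\<dots> = add_pow R (r ^ k) \<one> \<otimes> add_pow R r \<one>" by (simp add: add_pow_ldistr)
    finally show ?case by (simp add: Suc)
  qed simp
  have "add_pow R (Coset.order R) \<one> = \<zero>"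
    using add.pow_order_eq_1[of \<one>] by (simp add: Coset.order_def)
  then have "add_pow R r \<one> [^] N = \<zero>" using pow assms by (simp add: Coset.order_def)
  then show ?thesis
  proof (induction N)
    case (Suc N)
    then show ?case using integral[of "add_pow R r \<one> [^] N" "add_pow R r \<one>"] by auto
  qed simp
qed

text \<open>Lagrange's theorem in the multiplicative group, multiplied once more by \<open>x\<close>
  so that zero is covered too.\<close>

lemma (in field) pow_card_eq_self:
  assumes "finite (carrier R)" "x \<in> carrier R"
  shows "x [^] card (carrier R) = x"
proof (cases "x = \<zero>")
  case True
  have "card (carrier R) \<noteq> 0" using assms by auto
  then show ?thesis using True by (simp add: nat_pow_zero)
next
  case False
  interpret G: group "Multiplicative_Group.mult_of R" by (rule field_mult_group)
  have card_pos: "card (carrier R) > 0" using assms by (auto simp: card_gt_0_iff)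
  have "x [^] (card (carrier R) - 1) = \<one>"
    using G.pow_order_eq_1[of x] False assms order_mult_of[OF assms(1)]
    by (simp add: Multiplicative_Group.nat_pow_mult_of Coset.order_def)
  then have "x [^] Suc (card (carrier R) - 1) = x" using assms by simp
  then show ?thesis using card_pos by simp
qed

text \<open>The degree bounds the number of roots from above. For the lower bound, the
  multiplicative group is cyclic of order \<open>N = d * m\<close> with generator \<open>a\<close>,
  and the powers of \<open>a\<close> with exponents \<open>m * i\<close>, \<open>i < d\<close>, are
  distinct roots.\<close>

lemma (in field) card_roots_of_unity:
  assumes fin: "finite (carrier R)" and d: "d > 0" "d dvd card (carrier R) - 1"
  shows "card {x \<in> carrier R. x [^] d = \<one>} = d"
proof (rule antisym)
  show "card {x \<in> carrier R. x [^] d = \<one>} \<le> d"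
    using num_roots_le_deg[OF fin] d by simp
  define N where "N = card (carrier R) - 1"
  have "card {\<zero>, \<one>} \<le> card (carrier R)" using fin by (intro card_mono) auto
  then have N: "N > 0" unfolding N_def by simp
  obtain m where m: "N = d * m" using d unfolding N_def by auto
  obtain a where a: "a \<in> carrier R - {\<zero>}" "carrier R - {\<zero>} = {a [^] i | i::nat. i \<in> UNIV}"
    using finite_field_mult_group_has_gen[OF fin] by auto
  have ac: "a \<in> carrier R" using a(1) by simp
  interpret G: group "Multiplicative_Group.mult_of R" by (rule field_mult_group)
  have aN: "a [^] N = \<one>"
    using G.pow_order_eq_1[of a] a order_mult_of[OF fin]
    by (simp add: Multiplicative_Group.nat_pow_mult_of Coset.order_def N_def)
  have a_mod: "a [^] i = a [^] (i mod N)" for i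
  proof -
    have "a [^] i = a [^] (N * (i div N) + i mod N)" by (simp only: mult_div_mod_eq)
    also have "\<dots> = (a [^] N) [^] (i div N) \<otimes> a [^] (i mod N)"
      using nat_pow_mult[OF ac] nat_pow_pow[OF ac] by metis
    finally show ?thesis using ac aN by simp
  qed
  have "carrier R - {\<zero>} \<subseteq> (\<lambda>i. a [^] i) ` {..<N}"
  proof
    fix x assume "x \<in> carrier R - {\<zero>}"
    then obtain i :: nat where "x = a [^] i" using a(2) by blast
    then have "x = a [^] (i mod N)" using a_mod by metis
    then show "x \<in> (\<lambda>i. a [^] i) ` {..<N}" using N by (intro image_eqI[where x = "i mod N"]) auto
  qed
  moreover have "(\<lambda>i::nat. a [^] i) ` {..<N} \<subseteq> carrier R - {\<zero>}" using a(2) by auto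
  ultimately have "(\<lambda>i. a [^] i) ` {..<N} = carrier R - {\<zero>}" by blast
  \<comment> \<open>A map from \<open>N\<close> exponents onto a set of \<open>N\<close> elements
    must be injective.\<close>
  then have inj: "inj_on (\<lambda>i. a [^] i) {..<N}"
    using fin by (intro eq_card_imp_inj_on) (auto simp: N_def card_Diff_singleton)
  have "m > 0" using N m by (cases m) auto
  have "inj_on (\<lambda>i. a [^] (m * i)) {..<d}"
    using inj_onD[OF inj] m \<open>m > 0\<close> by (intro inj_onI) fastforce
  then have "d = card ((\<lambda>i. a [^] (m * i)) ` {..<d})" by (simp add: card_image)
  also have "\<dots> \<le> card {x \<in> carrier R. x [^] d = \<one>}"
  proof (rule card_mono)
    have "(a [^] (m * i)) [^] d = \<one>" for i
    proof -
      have "(a [^] (m * i)) [^] d = (a [^] N) [^] i" using ac by (simp add: nat_pow_pow m ac_simps)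
      then show ?thesis using aN by simp
    qed
    then show "(\<lambda>i. a [^] (m * i)) ` {..<d} \<subseteq> {x \<in> carrier R. x [^] d = \<one>}"
      using ac by auto
  qed (use fin in simp)
  finally show "d \<le> card {x \<in> carrier R. x [^] d = \<one>}" .
qed

subsection \<open>Field extensions of prime degree\<close>

text \<open>The length of a nonzero coefficient list is its degree plus one, so the hypothesis
  provides more roots than the degree allows.\<close>

lemma (in field) poly_eq_Nil_if_many_roots:
  assumes g: "g \<in> carrier (poly_ring R)"
    and A: "A \<subseteq> carrier R" "finite A" "length g \<le> card A"
    and roots: "\<And>x. x \<in> A \<Longrightarrow> eval g x = \<zero>"
  shows "g = []"
proof (rule ccontr)
  assume nz: "g \<noteq> []"
  have "A \<subseteq> set_mset (roots g)"
  proof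
    fix x assume "x \<in> A"
    then have "is_root g x" using A(1) roots nz unfolding is_root_def by blast
    then show "x \<in># roots g" using roots_mem_iff_is_root[OF g] by blast
  qed
  then have "card A \<le> card (set_mset (roots g))" by (rule card_mono[OF finite_set_mset])
  also have "\<dots> = size (mset_set (set_mset (roots g)))" by simp
  also have "\<dots> \<le> size (roots g)"
    by (rule size_mset_mono[OF mset_set_set_mset_msubset])
  also have "\<dots> \<le> length g - 1" by (rule size_roots_le_degree[OF g])
  finally have "card A \<le> length g - 1" .
  moreover have "length g > 0" using nz by simp
  ultimately show False using A(3) by linarith
qed

text \<open>Stripping leading zeros is a bijection from all lists of length \<open>n\<close> over
  \<open>F\<close>; padding with zeros up to length \<open>n\<close> inverts it.\<close>

lemma (in ring) card_polys_length_le: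
  assumes F: "finite F" "\<zero> \<in> F"
  shows "card {g \<in> carrier (univ_poly R F). length g \<le> n} = card F ^ n"
proof -
  have "bij_betw normalize {l. set l \<subseteq> F \<and> length l = n} {g \<in> carrier (univ_poly R F). length g \<le> n}"
    unfolding bij_betw_def
  proof
    show "inj_on normalize {l. set l \<subseteq> F \<and> length l = n}"
    proof (rule inj_onI)
      fix l m assume "l \<in> {l. set l \<subseteq> F \<and> length l = n}" "m \<in> {l. set l \<subseteq> F \<and> length l = n}"
        and "normalize l = normalize m"
      then have "replicate (length l - length (normalize l)) \<zero> @ normalize l
          = replicate (length m - length (normalize m)) \<zero> @ normalize m" by simp
      then show "l = m" by (simp only: normalize_trick[symmetric])
    qed
    show "normalize ` {l. set l \<subseteq> F \<and> length l = n} = {g \<in> carrier (univ_poly R F). length g \<le> n}"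
    proof
      show "normalize ` {l. set l \<subseteq> F \<and> length l = n} \<subseteq> {g \<in> carrier (univ_poly R F). length g \<le> n}"
        using normalize_gives_polynomial normalize_length_le
        by (auto simp flip: univ_poly_carrier)
      show "{g \<in> carrier (univ_poly R F). length g \<le> n} \<subseteq> normalize ` {l. set l \<subseteq> F \<and> length l = n}"
      proof
        fix g assume "g \<in> {g \<in> carrier (univ_poly R F). length g \<le> n}"
        then have g: "polynomial F g" "length g \<le> n" by (auto simp: univ_poly_carrier)
        let ?l = "replicate (n - length g) \<zero> @ g"
        have "normalize ?l = g"
          using normalize_replicate_zero normalize_polynomial[OF g(1)] by simp
        moreover have "set ?l \<subseteq> F" "length ?l = n"
          using polynomial_incl[OF g(1)] F g(2) by auto
        ultimately show "g \<in> normalize ` {l. set l \<subseteq> F \<and> length l = n}"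
          by (intro image_eqI[where x = ?l]) auto
      qed
    qed
  qed
  from bij_betw_same_card[OF this] show ?thesis
    using card_lists_length_eq[OF F(1), of n] by simp
qed

section \<open>The Frobenius map and its fixed field\<close>

locale prime_degree_extension = field R for R (structure) +
  fixes q p :: nat
  assumes prime_p: "Factorial_Ring.prime p"
    and primepow_q: "primepow q"
    and card_R: "card (carrier R) = q ^ p"
begin

definition frob :: "'a \<Rightarrow> 'a" where "frob x = x [^] q"

lemma q_gt_1: "q > 1"
  using primepow_gt_Suc_0[OF primepow_q] by simp

lemma p_ge_2: "p \<ge> 2"
  using prime_ge_2_nat[OF prime_p] .

lemma q_less_power: "q < q ^ p"
  using power_strict_increasing[of 1 p q] q_gt_1 p_ge_2 by simp

lemma finite_R: "finite (carrier R)"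
  using card_R q_gt_1 by (intro card_ge_0_finite) simp

lemma frob_closed: "x \<in> carrier R \<Longrightarrow> frob x \<in> carrier R"
  by (simp add: frob_def)

lemma frob_mult: "x \<in> carrier R \<Longrightarrow> y \<in> carrier R \<Longrightarrow> frob (x \<otimes> y) = frob x \<otimes> frob y"
  by (simp add: frob_def nat_pow_distrib)

text \<open>The prime of which \<open>q\<close> is a power annihilates \<open>\<one>\<close>,
  because the order of the field is a power of the same prime.\<close>

lemma frob_add:
  assumes "x \<in> carrier R" "y \<in> carrier R"
  shows "frob (x \<oplus> y) = frob x \<oplus> frob y"
proof -
  obtain r k where r: "Factorial_Ring.prime r" "q = r ^ k"
    using primepow_q unfolding primepow_def by auto
  have "card (carrier R) = r ^ (k * p)" by (simp add: card_R r power_mult)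
  from prime_power_char_pow_add[OF r(1) char_of_prime_power_card[OF this] assms]
  show ?thesis unfolding frob_def unfolding r(2) .
qed

lemma frob_one: "frob \<one> = \<one>"
  by (simp add: frob_def)

lemma frob_zero: "frob \<zero> = \<zero>"
  using q_gt_1 by (simp add: frob_def nat_pow_zero)

lemma frob_funpow: "x \<in> carrier R \<Longrightarrow> (frob ^^ i) x = x [^] (q ^ i)"
  by (induction i) (simp_all add: frob_def nat_pow_pow mult.commute)

lemma frob_pow: "x \<in> carrier R \<Longrightarrow> frob (x [^] (i::nat)) = frob x [^] i"
  by (simp add: frob_def nat_pow_pow mult.commute)

lemma pow_q_power_p: "x \<in> carrier R \<Longrightarrow> x [^] (q ^ p) = x"
  using pow_card_eq_self[OF finite_R] card_R by simp

sublocale frob: prime_cyclic_map "carrier R" frob p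
  by unfold_locales (simp_all add: finite_R prime_p frob_closed frob_funpow pow_q_power_p)

abbreviation F :: "'a set" where "F \<equiv> frob.fixed"

lemma F_subset: "F \<subseteq> carrier R"
  by (auto simp: frob.fixed_def)

lemma finite_F: "finite F"
  using finite_subset[OF F_subset finite_R] .

text \<open>The fixed points of a ring endomorphism. Negatives and inverses of fixed points are
  fixed because they are unique.\<close>

lemma F_subfield: "subfield F R"
proof (rule subfieldI')
  show "subring F R"
  proof (rule subringI)
    fix h assume h: "h \<in> F"
    then have "frob h \<oplus> frob (\<ominus> h) = \<zero>"
      using frob_add[of h "\<ominus> h"] by (simp add: frob.fixed_def r_neg frob_zero)
    then have "frob (\<ominus> h) = \<ominus> h"
      using h by (intro minus_equality[symmetric]) (auto simp: frob.fixed_def frob_closed a_comm)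
    then show "\<ominus> h \<in> F" using h by (simp add: frob.fixed_def)
  qed (auto simp: frob.fixed_def frob_one frob_mult frob_add)
next
  fix k assume k: "k \<in> F - {\<zero>}"
  then have "k \<in> Units R" using field_Units F_subset by auto
  then have inv: "inv k \<in> carrier R" "k \<otimes> inv k = \<one>" by auto
  then have "k \<otimes> frob (inv k) = \<one>"
    using frob_mult[of k "inv k"] k by (simp add: frob.fixed_def frob_one)
  then have "inv k = frob (inv k)"
    using k inv by (intro comm_inv_char) (auto simp: frob.fixed_def frob_closed)
  then show "inv k \<in> F" using inv by (simp add: frob.fixed_def)
qed

lemma F_subring: "subring F R"
  using subfieldE(1)[OF F_subfield] .

text \<open>The fixed points are zero and the roots of unity of order dividing \<open>q - 1\<close>,
  and \<open>q - 1\<close> divides \<open>q ^ p - 1\<close>.\<close>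

lemma card_F: "card F = q"
proof -
  have "F = insert \<zero> {x \<in> carrier R. x [^] (q - 1) = \<one>}"
  proof (intro Set.set_eqI)
    fix x
    have "frob x = x \<longleftrightarrow> x = \<zero> \<or> x [^] (q - 1) = \<one>" if x: "x \<in> carrier R"
    proof (cases "x = \<zero>")
      case False
      have "frob x = x [^] Suc (q - 1)" unfolding frob_def using q_gt_1 by simp
      then have "frob x = x \<longleftrightarrow> x [^] (q - 1) \<otimes> x = \<one> \<otimes> x" using x by simp
      also have "\<dots> \<longleftrightarrow> x [^] (q - 1) = \<one>" using x False by (subst m_rcancel) auto
      finally show ?thesis using False by simp
    qed (simp add: frob_zero)
    then show "x \<in> F \<longleftrightarrow> x \<in> insert \<zero> {x \<in> carrier R. x [^] (q - 1) = \<one>}"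
      by (auto simp: frob.fixed_def)
  qed
  moreover have "\<zero> \<notin> {x \<in> carrier R. x [^] (q - 1) = \<one>}"
    using q_gt_1 by (simp add: nat_pow_zero)
  moreover have "q - 1 dvd q ^ p - 1"
  proof -
    have "int (q - 1) dvd int (q ^ p - 1)"
      using power_diff_1_eq[of "int q" p] q_gt_1 by simp
    then show ?thesis by (simp only: int_dvd_int_iff)
  qed
  ultimately show ?thesis
    using card_roots_of_unity[OF finite_R, of "q - 1"] finite_R q_gt_1 card_R by simp
qed

text \<open>Every element of a subfield with \<open>q\<close> elements equals its own
  \<open>q\<close>-th power. Such a subfield thus lies in \<open>F\<close>, which has the same
  size.\<close>

lemma subfield_of_order_q: "subfield_of_order R q = F"
  unfolding subfield_of_order_def
proof (rule the_equality)
  fix G assume G: "subfield G R \<and> card G = q"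
  interpret G: field "R\<lparr>carrier := G\<rparr>" using subfield_iff(2) G by blast
  have GR: "G \<subseteq> carrier R" using G subfieldE(3) by blast
  have fin: "finite G" using finite_subset[OF GR finite_R] .
  have "x [^] q = x" if "x \<in> G" for x
    using G.pow_card_eq_self[of x] fin that G by (simp flip: nat_pow_consistent)
  then have "G \<subseteq> F" using GR by (auto simp: frob.fixed_def frob_def)
  then show "G = F" using card_subset_eq[OF finite_F] G card_F by simp
qed (use F_subfield card_F in simp)

lemma subfield_of_order_q_power_p: "subfield_of_order R (q ^ p) = carrier R"
  unfolding subfield_of_order_def
proof (rule the_equality)
  show "subfield (carrier R) R \<and> card (carrier R) = q ^ p"
    using carrier_is_subfield card_R by simp
  show "G = carrier R" if "subfield G R \<and> card G = q ^ p" for G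
    using that card_subset_eq[OF finite_R, of G] subfieldE(3)[of G R] card_R by simp
qed

lemma moved_eq: "frob.moved = carrier R - F"
  by (auto simp: frob.fixed_def frob.moved_def)

lemma card_moved: "card frob.moved = q ^ p - q"
  unfolding moved_eq using card_Diff_subset[OF finite_F F_subset] card_R card_F by simp

text \<open>The divisors of \<open>p\<close> are 1 and \<open>p\<close>, so only the pair
  \<open>d = p\<close>, \<open>s = 1\<close> gives a nonempty difference; \<open>F\<close> is
  preserved by every commuting map. Two functions occur because \<open>induced_map\<close> is not
  extensional, whereas \<open>commuting_maps\<close> contains extensional maps.\<close>

lemma subfield_preserving_iff:
  assumes "\<And>x. x \<in> carrier R \<Longrightarrow> g x = f x" "f \<in> frob.commuting_maps (carrier R)"
  shows "subfield_preserving R q p g \<longleftrightarrow> f \<in> frob.commuting_maps frob.moved"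
proof -
  have f: "f x \<in> carrier R" "f (frob x) = frob (f x)" if "x \<in> carrier R" for x
    using assms(2) that by (auto simp: frob.commuting_maps_def PiE_iff)
  have g: "g \<in> carrier R \<rightarrow> carrier R" using assms(1) f by auto
  have gF: "g ` F \<subseteq> F"
  proof clarify
    fix x assume "x \<in> F"
    then show "g x \<in> F" using f[of x] assms(1)[of x] by (simp add: frob.fixed_def)
  qed
  have divisors: "0 < d \<and> d dvd p \<longleftrightarrow> d = 1 \<or> d = p" for d
    using prime_p p_ge_2 by (auto simp: prime_nat_iff)
  have "subfield_preserving R q p g \<longleftrightarrow> g ` (carrier R - F) \<subseteq> carrier R - F"
    unfolding subfield_preserving_def subfield_of_order_q
  proof (intro iffI conjI allI impI)
    assume *: "g \<in> carrier R \<rightarrow> carrier R \<and> g ` F \<subseteq> F \<and>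
      (\<forall>d s. 0 < d \<and> d dvd p \<and> 0 < s \<and> s dvd p \<longrightarrow>
         g ` (subfield_of_order R (q ^ d) - subfield_of_order R (q ^ s))
           \<subseteq> subfield_of_order R (q ^ d) - subfield_of_order R (q ^ s))"
    from conjunct2[OF conjunct2[OF *], rule_format, of p 1]
    show "g ` (carrier R - F) \<subseteq> carrier R - F"
      using p_ge_2 by (simp add: subfield_of_order_q subfield_of_order_q_power_p)
  next
    fix d s assume *: "g ` (carrier R - F) \<subseteq> carrier R - F"
      and "0 < d \<and> d dvd p \<and> 0 < s \<and> s dvd p"
    then have "(d = 1 \<or> d = p) \<and> (s = 1 \<or> s = p)" using divisors by blast
    then show "g ` (subfield_of_order R (q ^ d) - subfield_of_order R (q ^ s))
           \<subseteq> subfield_of_order R (q ^ d) - subfield_of_order R (q ^ s)"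
      using * F_subset by (elim conjE disjE)
        (simp_all add: subfield_of_order_q subfield_of_order_q_power_p Diff_eq_empty_iff[THEN iffD2])
  qed (use g gF in auto)
  also have "\<dots> \<longleftrightarrow> f ` frob.moved \<subseteq> frob.moved"
    using assms(1) unfolding moved_eq by (auto simp: image_subset_iff)
  also have "\<dots> \<longleftrightarrow> f \<in> frob.commuting_maps frob.moved"
    using assms(2) by (auto simp: frob.commuting_maps_def)
  finally show ?thesis .
qed

text \<open>Frobenius respects sums and products and fixes the coefficients. This is why residue
  classes induce commuting maps.\<close>

lemma eval_frob:
  "set l \<subseteq> F \<Longrightarrow> x \<in> carrier R \<Longrightarrow> eval l (frob x) = frob (eval l x)"
proof (induction l)
  case (Cons a l)
  then have "a \<in> carrier R" "frob a = a" "set l \<subseteq> carrier R"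
    using F_subset by (auto simp: frob.fixed_def)
  then show ?case
    using Cons by (simp add: frob_add frob_mult frob_pow eval_in_carrier)
qed (simp add: frob_zero)

section \<open>The quotient ring and its representatives\<close>

definition frob_poly :: "'a list"
  where "frob_poly = X [^]\<^bsub>univ_poly R F\<^esub> (q ^ p) \<ominus>\<^bsub>univ_poly R F\<^esub> X"

lemma frob_poly_closed: "frob_poly \<in> carrier (univ_poly R F)"
proof -
  interpret UP: domain "univ_poly R F" using univ_poly_is_domain[OF F_subring] .
  show ?thesis unfolding frob_poly_def
    using var_closed(1)[OF F_subring] var_pow_closed[OF F_subring] by simp
qed

lemma length_frob_poly: "length frob_poly = Suc (q ^ p)"
proof -
  interpret UP: domain "univ_poly R F" using univ_poly_is_domain[OF F_subring] .
  have X: "X \<in> carrier (univ_poly R F)" using var_closed(1)[OF F_subring] .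
  have XN: "X [^]\<^bsub>univ_poly R F\<^esub> (q ^ p) = \<one> # replicate (q ^ p) \<zero>"
    using unitary_monom_eq_var_pow[OF F_subring, of "q ^ p"] by (simp add: monom_def)
  have lenX: "length (\<ominus>\<^bsub>univ_poly R F\<^esub> X) = 2"
    using univ_poly_a_inv_length[OF F_subring X] by (simp add: var_def)
  \<comment> \<open>The two summands have lengths \<open>Suc (q ^ p)\<close> and 2. These differ, so
    the leading coefficients cannot cancel.\<close>
  have "q ^ p \<noteq> 1" "max (q ^ p) (Suc 0) = q ^ p" using q_less_power q_gt_1 by linarith+
  then have "length (poly_add (\<one> # replicate (q ^ p) \<zero>) (\<ominus>\<^bsub>univ_poly R F\<^esub> X)) = Suc (q ^ p)"
    using poly_add_length_eq[OF F_subring, of "\<one> # replicate (q ^ p) \<zero>" "\<ominus>\<^bsub>univ_poly R F\<^esub> X"]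
      var_pow_closed[OF F_subring, of "q ^ p"] UP.a_inv_closed[OF X] lenX
    by (simp add: XN univ_poly_carrier del: poly_add.simps)
  then show ?thesis unfolding frob_poly_def a_minus_def XN univ_poly_add .
qed

lemma eval_frob_poly:
  assumes "x \<in> carrier R" shows "eval frob_poly x = \<zero>"
proof -
  interpret ev: ring_hom_ring "univ_poly R F" R "\<lambda>g. eval g x"
    using eval_ring_hom[OF F_subring assms] .
  have "eval frob_poly x = eval X x [^] (q ^ p) \<ominus> eval X x"
    using var_closed(1)[OF F_subring] var_pow_closed[OF F_subring, of "q ^ p"]
    unfolding frob_poly_def a_minus_def by (simp add: ev.hom_nat_pow)
  then show ?thesis
    using assms by (simp add: eval_var pow_q_power_p r_neg a_minus_def)
qed

lemma reduced_poly_ring_eq: "reduced_poly_ring R q p = Rupt F frob_poly"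
  by (simp add: reduced_poly_ring_def rupture_def frob_poly_def subfield_of_order_q Let_def)

text \<open>Length at most \<open>q ^ p\<close> means degree below \<open>q ^ p\<close>, or the zero
  polynomial: these are the remainders modulo \<open>frob_poly\<close>, one in each residue
  class.\<close>

definition short_polys :: "'a list set"
  where "short_polys = {g \<in> carrier (univ_poly R F). length g \<le> q ^ p}"

lemma short_polys_eq: "short_polys = (\<lambda>g. g pmod frob_poly) ` carrier (univ_poly R F)"
proof -
  have "frob_poly \<noteq> []" using length_frob_poly by auto
  then show ?thesis
    using pmod_image_characterization[OF F_subfield frob_poly_closed] length_frob_poly by (simp add: short_polys_def)
qed

lemma card_short_polys: "card short_polys = q ^ (q ^ p)"
  unfolding short_polys_def
  using card_polys_length_le[OF finite_F, of "q ^ p"] subringE(2)[OF F_subring] card_F by simp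

lemma bij_betw_rupture_surj: "bij_betw (rupture_surj F frob_poly) short_polys (carrier (reduced_poly_ring R q p))"
  unfolding bij_betw_def short_polys_eq reduced_poly_ring_eq
  using rupture_surj_inj_on[OF F_subfield frob_poly_closed]
    rupture_carrier_as_pmod_image[OF F_subfield frob_poly_closed] by simp

text \<open>The class of \<open>g\<close> is its coset by the multiples of \<open>frob_poly\<close>,
  all of which vanish on the field. The set of values at \<open>x\<close> is thus a singleton, and
  \<open>the_elem\<close> picks its element.\<close>

lemma induced_map_rupture_surj:
  assumes g: "g \<in> carrier (univ_poly R F)" and x: "x \<in> carrier R"
  shows "induced_map R (rupture_surj F frob_poly g) x = eval g x"
proof -
  interpret ev: ring_hom_ring "univ_poly R F" R "\<lambda>g. eval g x"
    using eval_ring_hom[OF F_subring x] .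
  have coset: "rupture_surj F frob_poly g
      = (\<lambda>h. h \<otimes>\<^bsub>univ_poly R F\<^esub> frob_poly \<oplus>\<^bsub>univ_poly R F\<^esub> g) ` carrier (univ_poly R F)"
    unfolding a_r_coset_def' cgenideal_def by blast
  have "eval (h \<otimes>\<^bsub>univ_poly R F\<^esub> frob_poly \<oplus>\<^bsub>univ_poly R F\<^esub> g) x = eval g x"
    if "h \<in> carrier (univ_poly R F)" for h
    using that g x frob_poly_closed by (simp add: eval_frob_poly)
  then have "(\<lambda>g. eval g x) ` rupture_surj F frob_poly g = (\<lambda>_. eval g x) ` carrier (univ_poly R F)"
    unfolding coset image_image by (rule image_cong[OF refl])
  also have "\<dots> = {eval g x}" using g by blast
  finally have "(\<lambda>g. eval g x) ` rupture_surj F frob_poly g = {eval g x}" .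
  then show ?thesis by (simp add: induced_map_def)
qed

section \<open>Counting the induced maps and the probability\<close>

lemma card_commuting_maps_carrier: "card (frob.commuting_maps (carrier R)) = q ^ (q ^ p)"
proof -
  \<comment> \<open>As an identity of exponents of \<open>q\<close>, this turns the orbit count into
    the number of short polynomials.\<close>
  have "q + p * ((q ^ p - q) div p) = q ^ p"
    using dvd_mult_div_cancel[OF frob.p_dvd_card_moved] q_less_power unfolding card_moved by linarith
  from arg_cong[OF this, of "\<lambda>k. q ^ k"]
  have "q ^ (q ^ p) = q ^ q * (q ^ p) ^ ((q ^ p - q) div p)"
    unfolding power_add power_mult by (rule sym)
  then show ?thesis
    using frob.card_commuting_maps[OF subset_refl frob_closed]
    unfolding card_F card_R card_moved by simp
qed

lemma card_commuting_maps_moved: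
  "card (frob.commuting_maps frob.moved) = q ^ q * (q ^ p - q) ^ ((q ^ p - q) div p)"
proof -
  have "frob.moved \<subseteq> carrier R" by (auto simp: frob.moved_def)
  moreover have "frob x \<in> frob.moved" if "x \<in> frob.moved" for x
    using frob.funpow_in_moved[OF that, of 1] by simp
  ultimately show ?thesis
    using frob.card_commuting_maps[of frob.moved] unfolding card_F card_moved by blast
qed

lemma finite_commuting_maps: "finite (frob.commuting_maps B)"
  unfolding frob.commuting_maps_def
  by (rule finite_subset[of _ "carrier R \<rightarrow>\<^sub>E carrier R"]) (auto intro: finite_PiE finite_R)

text \<open>Surjectivity is a counting argument: both sides have \<open>q ^ (q ^ p)\<close> elements.\<close>

lemma bij_betw_eval:
  "bij_betw (\<lambda>g. restrict (eval g) (carrier R)) short_polys (frob.commuting_maps (carrier R))"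
  unfolding bij_betw_def
proof
  interpret UP: domain "univ_poly R F" using univ_poly_is_domain[OF F_subring] .
  have poly_closed: "g \<in> carrier (univ_poly R F)" if "g \<in> short_polys" for g using that by (simp add: short_polys_def)
  show inj: "inj_on (\<lambda>g. restrict (eval g) (carrier R)) short_polys"
  proof (rule inj_onI)
    fix g h assume g: "g \<in> short_polys" and h: "h \<in> short_polys"
      and eq: "restrict (eval g) (carrier R) = restrict (eval h) (carrier R)"
    let ?d = "g \<ominus>\<^bsub>univ_poly R F\<^esub> h"
    have d: "?d \<in> carrier (univ_poly R F)" using poly_closed g h by simp
    have "length g \<le> q ^ p" "length (\<ominus>\<^bsub>univ_poly R F\<^esub> h) \<le> q ^ p"
      using g h univ_poly_a_inv_length[OF F_subring poly_closed[OF h]] by (simp_all add: short_polys_def)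
    then have "length ?d \<le> q ^ p"
      using poly_add_length_le[of g "\<ominus>\<^bsub>univ_poly R F\<^esub> h"]
      unfolding a_minus_def univ_poly_add by linarith
    moreover have "eval ?d x = \<zero>" if x: "x \<in> carrier R" for x
    proof -
      interpret ev: ring_hom_ring "univ_poly R F" R "\<lambda>g. eval g x"
        using eval_ring_hom[OF F_subring x] .
      have "eval g x = eval h x" using fun_cong[OF eq, of x] x by simp
      then show ?thesis
        using poly_closed[OF g] poly_closed[OF h] by (simp add: a_minus_def r_neg)
    qed
    \<comment> \<open>The difference is also a polynomial over the whole field, where it has
      \<open>q ^ p\<close> roots but length at most \<open>q ^ p\<close>.\<close>
    ultimately have "?d = []"
      using carrier_polynomial_shell[OF F_subring d] finite_R card_R
      by (intro poly_eq_Nil_if_many_roots[of _ "carrier R"]) auto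
    then show "g = h" using poly_closed[OF g] poly_closed[OF h] by (simp flip: univ_poly_zero[of R F])
  qed
  have "(\<lambda>g. restrict (eval g) (carrier R)) ` short_polys \<subseteq> frob.commuting_maps (carrier R)"
  proof clarify
    fix g assume "g \<in> short_polys"
    then have g: "set g \<subseteq> F"
      using polynomial_incl poly_closed by (simp add: univ_poly_carrier)
    then have "set g \<subseteq> carrier R" using F_subset by blast
    then show "restrict (eval g) (carrier R) \<in> frob.commuting_maps (carrier R)"
      using eval_in_carrier eval_frob[OF g] frob_closed
      by (auto simp: frob.commuting_maps_def frob.moved_def)
  qed
  then show "(\<lambda>g. restrict (eval g) (carrier R)) ` short_polys = frob.commuting_maps (carrier R)"
    using card_image[OF inj] unfolding card_short_polys
    by (intro card_subset_eq finite_commuting_maps) (simp_all only: card_commuting_maps_carrier)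
qed

text \<open>Two bijections carry the favourable classes to short polynomials and on to
  \<open>commuting_maps moved\<close>; the factor \<open>q ^ q\<close> cancels in the ratio of
  counts. The real exponent in \<open>powr\<close> equals the integer \<open>N\<close> and suits the
  limit.\<close>

lemma prob_subfield_preserving_eq:
  "prob_subfield_preserving R q p
     = (1 - real q / real q ^ p) powr ((real q ^ p - real q) / real p)"
proof -
  let ?C = "carrier (reduced_poly_ring R q p)"
  let ?good = "{C. subfield_preserving R q p (induced_map R C)}"
  let ?ev = "\<lambda>g. restrict (eval g) (carrier R)"
  define N where "N = (q ^ p - q) div p"
  have finS: "finite short_polys" using card_short_polys q_gt_1 by (intro card_ge_0_finite) simp
  have finC: "finite ?C" using bij_betw_finite[OF bij_betw_rupture_surj] finS by simp
  have cardC: "card ?C = q ^ (q ^ p)" using bij_betw_same_card[OF bij_betw_rupture_surj] card_short_polys by simp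
  have "card ?C > 0" using cardC q_gt_1 by simp
  then have neC: "?C \<noteq> {}" by auto
  have good: "subfield_preserving R q p (induced_map R (rupture_surj F frob_poly g))
      \<longleftrightarrow> ?ev g \<in> frob.commuting_maps frob.moved" if g: "g \<in> short_polys" for g
  proof (rule subfield_preserving_iff)
    have gc: "g \<in> carrier (univ_poly R F)" using g by (simp add: short_polys_def)
    show "induced_map R (rupture_surj F frob_poly g) x = ?ev g x" if "x \<in> carrier R" for x
      using induced_map_rupture_surj[OF gc that] that by simp
    show "?ev g \<in> frob.commuting_maps (carrier R)"
      using bij_betwE[OF bij_betw_eval] g by blast
  qed
  \<comment> \<open>\<open>T\<close> is the set of favourable short polynomials, the link between
    classes and maps: it is counted through both bijections.\<close>
  define T where "T = {g \<in> short_polys. ?ev g \<in> frob.commuting_maps frob.moved}"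
  have TS: "T \<subseteq> short_polys" unfolding T_def by blast
  have "?C \<inter> ?good = rupture_surj F frob_poly ` T"
    unfolding bij_betw_imp_surj_on[OF bij_betw_rupture_surj, symmetric] T_def using good by blast
  then have "card (?C \<inter> ?good) = card T"
    using card_image[OF inj_on_subset[OF bij_betw_imp_inj_on[OF bij_betw_rupture_surj] TS]] by metis
  also have "card T = card (?ev ` T)"
    using card_image[OF inj_on_subset[OF bij_betw_imp_inj_on[OF bij_betw_eval] TS]] by (rule sym)
  also have "?ev ` T = frob.commuting_maps frob.moved"
  proof -
    have "frob.commuting_maps frob.moved \<subseteq> frob.commuting_maps (carrier R)"
      by (auto simp: frob.commuting_maps_def frob.moved_def PiE_iff)
    then show ?thesis
      unfolding bij_betw_imp_surj_on[OF bij_betw_eval, symmetric] T_def by blast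
  qed
  also have "card (frob.commuting_maps frob.moved) = q ^ q * (q ^ p - q) ^ N"
    unfolding N_def by (rule card_commuting_maps_moved)
  finally have card_good: "card (?C \<inter> ?good) = q ^ q * (q ^ p - q) ^ N" .
  have pN: "p * N = q ^ p - q"
    using dvd_mult_div_cancel[OF frob.p_dvd_card_moved] unfolding card_moved N_def .
  then have "q ^ p = q + p * N" using q_less_power by linarith
  from arg_cong[OF this, of "\<lambda>k. q ^ k"] have "q ^ (q ^ p) = q ^ q * (q ^ p) ^ N"
    unfolding power_add power_mult .
  then have prob: "prob_subfield_preserving R q p = real (q ^ q * (q ^ p - q) ^ N) / real (q ^ q * (q ^ p) ^ N)"
    unfolding prob_subfield_preserving_def measure_pmf_of_set[OF neC finC]
    by (simp only: card_good cardC)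
  have cancel: "real (c * a ^ N) / real (c * b ^ N) = (real a / real b) ^ N" if "c > 0" for a b c :: nat
    using that by (simp add: power_divide)
  note prob
  also have "real (q ^ q * (q ^ p - q) ^ N) / real (q ^ q * (q ^ p) ^ N) = (real (q ^ p - q) / real (q ^ p)) ^ N"
    using q_gt_1 by (intro cancel) simp
  also have "real (q ^ p - q) / real (q ^ p) = 1 - real q / real q ^ p"
    using q_less_power q_gt_1 by (simp add: diff_divide_distrib)
  also have "\<dots> ^ N = (1 - real q / real q ^ p) powr real N"
  proof -
    have "real q < real q ^ p" using q_less_power by (metis of_nat_less_iff of_nat_power)
    then have "1 - real q / real q ^ p > 0" using q_gt_1 by (simp add: field_simps)
    then show ?thesis by (simp add: powr_realpow)
  qed
  also have "real N = (real q ^ p - real q) / real p"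
  proof -
    have "real p * real N = real q ^ p - real q"
      using pN q_less_power by (metis of_nat_diff of_nat_mult of_nat_power order_less_imp_le)
    then show ?thesis using p_ge_2 by (simp add: field_simps)
  qed
  finally show ?thesis .
qed

end

subsection \<open>The limit\<close>

lemma powr_tendsto_exp_neg:
  fixes p q :: "nat \<Rightarrow> nat" and L :: ennreal
  assumes p: "\<And>n. p n \<ge> 2" and q: "\<And>n. q n \<ge> 2"
    and inf: "filterlim p at_top sequentially \<or> filterlim q at_top sequentially"
    and L: "(\<lambda>n. ennreal (real (q n) / real (p n))) \<longlonglongrightarrow> L"
    and P: "\<And>n. P n = (1 - real (q n) / real (q n) ^ p n) powr
                  ((real (q n) ^ p n - real (q n)) / real (p n))"
  shows "P \<longlonglongrightarrow> exp_neg L"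
proof -
  define u where "u n = real (q n) / real (q n) ^ p n" for n
  define a where "a n = real (q n) / real (p n)" for n
  define g where "g n = (1 - u n) * (ln (1 - u n) / u n)" for n
  \<comment> \<open>One factor \<open>q\<close> cancels. As \<open>p \<ge> 2\<close>, the remaining
    power is at least \<open>q\<close> and at least 2 to the \<open>p - 1\<close>, so either
    alternative of \<open>inf\<close> forces \<open>u\<close> to 0.\<close>
  have u_eq: "u n = 1 / real (q n) ^ (p n - 1)" for n
    using p[of n] q[of n] unfolding u_def by (cases "p n") auto
  have u_pos: "u n > 0" for n unfolding u_def using q[of n] by simp
  have pow_ge: "real (q n) ^ (p n - 1) \<ge> real (q n)" for n
    using p[of n] q[of n] power_increasing[of 1 "p n - 1" "real (q n)"] by simp
  have u_le_q: "u n \<le> 1 / real (q n)" for n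
    unfolding u_eq using pow_ge[of n] q[of n] by (intro divide_left_mono) auto
  have u_le_p: "u n \<le> (1/2) ^ (p n - 1)" for n
    unfolding u_eq power_one_over using q[of n] by (intro divide_left_mono power_mono) auto
  have u_lt: "u n < 1" for n
  proof -
    have "1 / real (q n) \<le> 1 / 2" using q[of n] by (intro divide_left_mono) auto
    then show ?thesis using u_le_q[of n] by linarith
  qed
  have u0: "u \<longlonglongrightarrow> 0"
  proof -
    from inf consider "filterlim p at_top sequentially" | "filterlim q at_top sequentially" by auto
    then show ?thesis
    proof cases
      case 1
      have "filterlim (\<lambda>k::nat. (1/2::real) ^ (k - 1)) (nhds 0) at_top" by real_asymp
      from filterlim_compose[OF this 1] have lim: "(\<lambda>n. (1/2::real) ^ (p n - 1)) \<longlonglongrightarrow> 0" .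
      show ?thesis
        by (rule tendsto_sandwich[OF _ _ tendsto_const lim])
          (auto intro!: always_eventually u_le_p[simplified] less_imp_le[OF u_pos])
    next
      case 2
      have "filterlim (\<lambda>k::nat. 1 / real k) (nhds 0) at_top" by real_asymp
      from filterlim_compose[OF this 2] have lim: "(\<lambda>n. 1 / real (q n)) \<longlonglongrightarrow> 0" .
      show ?thesis
        by (rule tendsto_sandwich[OF _ _ tendsto_const lim])
          (auto intro!: always_eventually u_le_q less_imp_le[OF u_pos])
    qed
  qed
  have g: "g \<longlonglongrightarrow> -1"
  proof -
    \<comment> \<open>Since \<open>u\<close> stays positive, the limit from the right is
      enough.\<close>
    have "filterlim (\<lambda>x::real. (1 - x) * (ln (1 - x) / x)) (nhds (-1)) (at_right 0)" by real_asymp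
    moreover have "filterlim u (at_right 0) sequentially"
      unfolding filterlim_at using u0 u_pos
      by (metis (mono_tags, lifting) always_eventually greaterThan_iff order_less_irrefl)
    ultimately show ?thesis unfolding g_def by (rule filterlim_compose)
  qed
  have P_eq: "P = (\<lambda>n. exp (a n * g n))"
  proof
    fix n
    \<comment> \<open>Substituting \<open>q / u\<close> for the power isolates the ratio
      \<open>a\<close> in the exponent, leaving a factor that depends on \<open>u\<close>
      alone.\<close>
    have "real (q n) ^ p n = real (q n) / u n" using q[of n] unfolding u_def by simp
    then have "(real (q n) ^ p n - real (q n)) / real (p n) = a n * ((1 - u n) / u n)"
      using u_pos[of n] p[of n] unfolding a_def by (simp add: field_simps)
    then have "P n = (1 - u n) powr (a n * ((1 - u n) / u n))"
      unfolding P u_def[symmetric] by simp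
    then show "P n = exp (a n * g n)" using u_lt[of n] unfolding powr_def g_def by (simp add: mult_ac)
  qed
  have a_nonneg: "a n \<ge> 0" for n unfolding a_def by simp
  show ?thesis
  proof (cases "L = \<infinity>")
    case True
    then have "filterlim a at_top sequentially"
      using L unfolding a_def[symmetric] by (simp add: ennreal_tendsto_top_eq_at_top)
    \<comment> \<open>With a negative limit for \<open>g\<close> and \<open>a\<close> tending to
      infinity, the exponent tends to minus infinity, which matches the value 0 of
      \<open>exp_neg\<close> at infinity.\<close>
    from filterlim_tendsto_neg_mult_at_bot[OF g _ this] have "filterlim (\<lambda>n. g n * a n) at_bot sequentially"
      by simp
    from filterlim_compose[OF exp_at_bot this] show ?thesis
      using True by (simp add: P_eq exp_neg_def mult.commute)
  next
    case False
    then obtain l where l: "L = ennreal l" "l \<ge> 0" by (cases L) auto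
    then have "a \<longlonglongrightarrow> l"
      using L a_nonneg unfolding a_def[symmetric] by simp
    then have "(\<lambda>n. exp (a n * g n)) \<longlonglongrightarrow> exp (l * -1)"
      by (intro tendsto_intros g)
    then show ?thesis using l by (simp add: P_eq exp_neg_def)
  qed
qed

theorem theorem20:
  fixes p q :: "nat \<Rightarrow> nat"
    and K :: "nat \<Rightarrow> ('a, 'b) ring_scheme"
    and L :: ennreal
  assumes "\<And>n. Factorial_Ring.prime (p n)"
    and "\<And>n. primepow (q n)"
    and "\<And>n. field (K n)"
    and "\<And>n. card (carrier (K n)) = q n ^ p n"
    and "filterlim p at_top sequentially \<or> filterlim q at_top sequentially"
    and "(\<lambda>n. ennreal (real (q n) / real (p n))) \<longlonglongrightarrow> L"
  shows "(\<lambda>n. prob_subfield_preserving (K n) (q n) (p n)) \<longlonglongrightarrow> exp_neg L"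
proof (rule powr_tendsto_exp_neg[where p = p and q = q])
  fix n
  interpret prime_degree_extension "K n" "q n" "p n"
    using assms(1-4) by (intro prime_degree_extension.intro prime_degree_extension_axioms.intro)
  show "p n \<ge> 2" by (rule p_ge_2)
  show "q n \<ge> 2" using q_gt_1 by simp
  show "prob_subfield_preserving (K n) (q n) (p n) = (1 - real (q n) / real (q n) ^ p n) powr
      ((real (q n) ^ p n - real (q n)) / real (p n))"
    by (rule prob_subfield_preserving_eq)
qed (use assms in auto)

end
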